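(* Let $p\ge 1$ and $W\ge 2p$ be integers, let $\alpha_0=1$ and $\alpha_i=-\phi_i$ for $1\le i\le p$, where $\phi_1,\dots,\phi_p\in\mathbb{R}$ and $\phi_p\neq 0$, and let $\mathbf{W}=(w_{i,j})_{i,j=0}^{W}$ be the AR($p$) matrix with these coefficients (defined in the context). If $|\phi_p|<1$ (in particular, if the AR($p$) model is stationary), then there do not exist positive integers $A,B$ with $B\ge p$, a real matrix $\mathbf{A}=(a_{i,j})_{i,j=0}^{A}$ and a diagonal real matrix $\mathbf{B}=(b_{i,j})_{i,j=0}^{B}$ (so that $\mathbf{B}$ has size larger than $p\times p$) such that $\mathbf{W}=\mathbf{A}\ast\mathbf{B}$.
   Context: AR($p$) matrix: the AR($p$) model is $\xi_n=\sum_{i=1}^p\phi_i\xi_{n-i}+\varepsilon_n$, i.e. $\sum_{i=0}^p\alpha_i\xi_{n-i}=\varepsilon_n$, with $\operatorname{Var}\varepsilon_n=1$. The associated matrix (the inverse of the autocovariance matrix in the stationary case) is the symmetric $(2p+1)$-diagonal matrix $\mathbf{W}=(w_{i,j})_{i,j=0}^{W}$ given by - $w_{i,j}=\sum_{m=0}^{\min(i,j)}\alpha_m\alpha_{m+|i-j|}$ if $\max(i,j)<p$; - $w_{i,j}=\sum_{m=0}^{p-|i-j|}\alpha_m\alpha_{m+|i-j|}$ if $\max(i,j)\ge p$, $\min(i,j)\le W-p$ and $|i-j|\le p$; - $w_{i,j}=\sum_{m=0}^{\min(W-i,W-j)}\alpha_m\alpha_{m+|i-j|}$ if $\min(i,j)>W-p$;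 - $w_{i,j}=0$ otherwise. Matrix convolution: for $\mathbf{A}=(a_{i,j})_{i,j=0}^{A}$ and $\mathbf{B}=(b_{i,j})_{i,j=0}^{B}$ the matrix $\mathbf{C}=\mathbf{A}\ast\mathbf{B}=(c_{i,j})_{i,j=0}^{A+B}$ has entries $c_{i,j}=\sum_{k,l}a_{k,l}\,b_{i-k,j-l}$, the sum being over all $k,l$ with $\max\{0,i-B\}\le k\le\min\{A,i\}$, $\max\{0,j-B\}\le l\le\min\{A,j\}$. In particular $\mathbf{W}=\mathbf{A}\ast\mathbf{B}$ requires $W=A+B$. *)

theory Defs
  imports "HOL-Probability.Probability" "Jordan_Normal_Form.Matrix"
begin

text \<open>
  A matrix \<open>(a\<^sub>i\<^sub>j)\<close> with \<open>0 \<le> i, j \<le> N\<close> is an element of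
  \<^term>\<open>carrier_mat (N + 1) (N + 1)\<close>; entries are read off with \<open>$$\<close>.
\<close>

text \<open>
  Here \<open>if max i j < p\<close> etc. are tried in order. For \<open>N \<ge> 2 * p\<close> the three conditions exclude
  each other, and no subtraction below is ever truncated on the entries where it is used.
\<close>

definition ar_mat :: "nat \<Rightarrow> nat \<Rightarrow> (nat \<Rightarrow> real) \<Rightarrow> real mat" where
  "ar_mat p N \<alpha> = Matrix.mat (N + 1) (N + 1) (\<lambda>(i, j).
     let d = max i j - min i j in
     if max i j < p then
       (\<Sum>m = 0..min i j. \<alpha> m * \<alpha> (m + d))
     else if max i j \<ge> p \<and> min i j \<le> N - p \<and> d \<le> p then
       (\<Sum>m = 0..p - d. \<alpha> m * \<alpha> (m + d))
     else if min i j > N - p then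
       (\<Sum>m = 0..min (N - i) (N - j). \<alpha> m * \<alpha> (m + d))
     else 0)"

text \<open>
  The full two-dimensional convolution. The largest indices of \<open>A\<close> and \<open>B\<close> are
  \<open>dim - 1\<close>, and the truncated difference \<open>i - b\<close> on \<^typ>\<open>nat\<close> is \<open>max {0, i - b}\<close>.
  It is meant for matrices with at least one row and one column.
\<close>

definition mat_conv :: "'a :: semiring_0 mat \<Rightarrow> 'a mat \<Rightarrow> 'a mat" where
  "mat_conv A B =
     (let ar = dim_row A - 1; ac = dim_col A - 1;
          br = dim_row B - 1; bc = dim_col B - 1
      in Matrix.mat (ar + br + 1) (ac + bc + 1) (\<lambda>(i, j).
           \<Sum>k = i - br..min ar i. \<Sum>l = j - bc..min ac j.
             A $$ (k, l) * B $$ (i - k, j - l)))"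

text \<open>
  Second-order stationarity, on a probability space \<^term>\<open>M\<close>, of the autoregressive model of
  order \<open>p\<close>. The noise is white with unit variance and uncorrelated with the past of the
  process, i.e. the \<open>\<epsilon> n\<close> are the innovations. Without the last condition a non-causal
  stationary solution exists also for e.g. \<open>p = 1\<close>, \<open>\<phi> 1 = 2\<close>.
\<close>

definition (in prob_space) covariance :: "('a \<Rightarrow> real) \<Rightarrow> ('a \<Rightarrow> real) \<Rightarrow> real" where
  "covariance X Y = expectation (\<lambda>\<omega>. (X \<omega> - expectation X) * (Y \<omega> - expectation Y))"

definition (in prob_space) weakly_stationary :: "(int \<Rightarrow> 'a \<Rightarrow> real) \<Rightarrow> bool" where
  "weakly_stationary X \<longleftrightarrow>
     (\<forall>n. random_variable borel (X n) \<and> integrable M (\<lambda>\<omega>. (X n \<omega>)\<^sup>2)) \<and>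
     (\<forall>m n. expectation (X m) = expectation (X n)) \<and>
     (\<forall>m n h. covariance (X (m + h)) (X (n + h)) = covariance (X m) (X n))"

definition (in prob_space) unit_white_noise :: "(int \<Rightarrow> 'a \<Rightarrow> real) \<Rightarrow> bool" where
  "unit_white_noise X \<longleftrightarrow>
     (\<forall>n. random_variable borel (X n) \<and> integrable M (\<lambda>\<omega>. (X n \<omega>)\<^sup>2)) \<and>
     (\<forall>n. expectation (X n) = 0) \<and> (\<forall>n. variance (X n) = 1) \<and>
     (\<forall>m n. m \<noteq> n \<longrightarrow> covariance (X m) (X n) = 0)"

locale stationary_ar = prob_space M for M :: "'a measure" +
  fixes p :: nat and \<phi> :: "nat \<Rightarrow> real" and \<xi> \<epsilon> :: "int \<Rightarrow> 'a \<Rightarrow> real"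
  assumes stationary: "weakly_stationary \<xi>"
    and noise: "unit_white_noise \<epsilon>"
    and innovation: "m < n \<Longrightarrow> covariance (\<xi> m) (\<epsilon> n) = 0"
    and recursion: "AE \<omega> in M. \<xi> n \<omega> = (\<Sum>i = 1..p. \<phi> i * \<xi> (n - int i) \<omega>) + \<epsilon> n \<omega>"

end

theory Submission
  imports Defs "HOL-Computational_Algebra.Polynomial"
begin

text \<open>
  Non-factorization: for diagonal \<open>B\<close>, the generating polynomial of each diagonal of the convolution
  of \<open>A\<close> and \<open>B\<close> is that of \<open>A\<close> times the polynomial \<open>b(t)\<close> of the main diagonal of \<open>B\<close>. With
  \<open>n = W - p + 1\<close>, the \<open>p\<close>-th diagonal of the AR matrix shows that \<open>(1 - t) b(t)\<close> divides \<open>1 - t^n\<close>,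
  and the main diagonal that it divides \<open>U(t) - t^n V(t)\<close>, where \<open>U\<close> and \<open>V\<close> have the coefficients \<open>\<alpha>\<^sub>k\<^sup>2\<close> and \<open>\<alpha>\<^sub>p\<^sub>-\<^sub>k\<^sup>2\<close>.
  Hence it divides \<open>U - V\<close>, whose degree is too small, so \<open>U = V\<close> and \<open>\<alpha>\<^sub>p\<^sup>2 = \<alpha>\<^sub>0\<^sup>2 = 1\<close>.

  Stationary models: let \<open>F(u)\<close> be the variance of \<open>\<Sum> u\<^sub>i \<xi>\<^sub>-\<^sub>i\<close> over \<open>i < p\<close>, where \<open>u\<^sub>0 = 1\<close>.
  Substituting the recursion for \<open>\<xi>\<^sub>0\<close> and reversing time gives \<open>F(u) = 1 + \<phi>\<^sub>p\<^sup>2 F(u')\<close> for another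
  such \<open>u'\<close>. If \<open>\<bar>\<phi>\<^sub>p\<bar> \<ge> 1\<close>, iteration makes \<open>F(u)\<close> exceed every natural number.
\<close>

subsection \<open>Diagonals of convolutions\<close>

text \<open>Rows whose entry would fall outside the matrix contribute 0, so \<open>d\<close> may be
  any natural number and no summation bound is a truncated difference.\<close>

definition diag_poly :: "nat \<Rightarrow> 'a :: comm_semiring_0 mat \<Rightarrow> 'a poly" where
  "diag_poly d M = (\<Sum>i<dim_row M. monom (if i + d < dim_col M then M $$ (i, i + d) else 0) i)"

lemma coeff_diag_poly:
  "coeff (diag_poly d M) i = (if i < dim_row M \<and> i + d < dim_col M then M $$ (i, i + d) else 0)"
  by (simp add: diag_poly_def coeff_sum)

text \<open>A nonzero entry of \<open>B\<close> needs \<open>i - k = j - l\<close>, so on the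
  diagonal \<open>j = i + d\<close> only \<open>l = k + d\<close> survives and the double sum
  becomes a Cauchy product.\<close>

lemma diag_poly_mat_conv:
  fixes A B :: "'a :: comm_semiring_0 mat"
  assumes A: "A \<in> carrier_mat (a + 1) (a + 1)" and B: "B \<in> carrier_mat (b + 1) (b + 1)"
    and diag: "diagonal_mat B"
  shows "diag_poly d (mat_conv A B) = diag_poly d A * diag_poly 0 B"
proof (rule poly_eqI)
  fix i
  have dA: "dim_row A = a + 1" "dim_col A = a + 1" and dB: "dim_row B = b + 1" "dim_col B = b + 1"
    using A B by auto
  let ?h = "\<lambda>k. if k + d \<le> a then A $$ (k, k + d) * B $$ (i - k, i - k) else 0"
  show "coeff (diag_poly d (mat_conv A B)) i = coeff (diag_poly d A * diag_poly 0 B) i"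
  proof (cases "i + d \<le> a + b")
    case True
    have inner: "(\<Sum>l = i + d - b..min a (i + d). A $$ (k, l) * B $$ (i - k, i + d - l)) = ?h k"
      if k: "k \<in> {i - b..min a i}" for k
    proof -
      have "(\<Sum>l = i + d - b..min a (i + d). A $$ (k, l) * B $$ (i - k, i + d - l)) =
            (\<Sum>l = i + d - b..min a (i + d). if l = k + d then A $$ (k, k + d) * B $$ (i - k, i - k) else 0)"
      proof (rule sum.cong[OF refl])
        fix l assume l: "l \<in> {i + d - b..min a (i + d)}"
        show "A $$ (k, l) * B $$ (i - k, i + d - l) =
              (if l = k + d then A $$ (k, k + d) * B $$ (i - k, i - k) else 0)"
        proof (cases "l = k + d")
          case False
          hence "i - k \<noteq> i + d - l" "i - k < dim_row B" "i + d - l < dim_col B"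
            using k l dB by auto
          hence "B $$ (i - k, i + d - l) = 0" using diag unfolding diagonal_mat_def by blast
          thus ?thesis using False by simp
        qed (use k in simp)
      qed
      \<comment> \<open>The bounds on \<open>k\<close> put \<open>k + d\<close> between
        \<open>i + d - b\<close> and \<open>i + d\<close>, so only \<open>k + d \<le> a\<close>
        remains to be tested.\<close>
      also have "\<dots> = ?h k" using k by (auto simp: sum.delta)
      finally show ?thesis .
    qed
    have "coeff (diag_poly d (mat_conv A B)) i =
          (\<Sum>k = i - b..min a i. \<Sum>l = i + d - b..min a (i + d). A $$ (k, l) * B $$ (i - k, i + d - l))"
      using True by (simp add: coeff_diag_poly mat_conv_def Let_def dA dB)
    also have "\<dots> = (\<Sum>k = i - b..min a i. ?h k)"
      by (rule sum.cong[OF refl inner])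
    also have "\<dots> = (\<Sum>k\<le>i. coeff (diag_poly d A) k * coeff (diag_poly 0 B) (i - k))"
      by (rule sum.mono_neutral_cong_left) (auto simp: coeff_diag_poly dA dB)
    finally show ?thesis by (simp add: coeff_mult)
  next
    case False
    \<comment> \<open>\<open>k + d \<le> a\<close> and \<open>i - k \<le> b\<close> cannot both hold
      here: they add up to \<open>i + d \<le> a + b\<close>.\<close>
    have "coeff (diag_poly d A) k * coeff (diag_poly 0 B) (i - k) = 0" if "k \<le> i" for k
      using that False by (auto simp: coeff_diag_poly dA dB)
    hence "coeff (diag_poly d A * diag_poly 0 B) i = 0" by (simp add: coeff_mult)
    thus ?thesis using False by (simp add: coeff_diag_poly mat_conv_def Let_def dA dB)
  qed
qed

subsection \<open>Diagonals of the AR matrix\<close>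

text \<open>The three defining cases are prefix sums of the squares; as
  \<open>2 * p \<le> N\<close>, their upper bounds \<open>i\<close>, \<open>p\<close> and
  \<open>N - i\<close> merge into one minimum.\<close>

lemma ar_mat_main_diagonal:
  assumes "2 * p \<le> N" "i \<le> N"
  shows "ar_mat p N \<alpha> $$ (i, i) = (\<Sum>m\<le>min (min i p) (N - i). (\<alpha> m)\<^sup>2)"
proof -
  consider "i < p" | "p \<le> i" "i \<le> N - p" | "N - p < i" by linarith
  thus ?thesis
  proof cases
    case 1
    hence "min (min i p) (N - i) = i" using assms by simp
    thus ?thesis using 1 assms by (simp add: ar_mat_def power2_eq_square atMost_atLeast0)
  next
    case 2
    hence "min (min i p) (N - i) = p" using assms by simp
    thus ?thesis using 2 assms by (simp add: ar_mat_def power2_eq_square atMost_atLeast0)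
  next
    case 3
    hence "min (min i p) (N - i) = N - i" using assms by simp
    thus ?thesis using 3 assms by (simp add: ar_mat_def power2_eq_square atMost_atLeast0)
  qed
qed

lemma coeff_one_minus_X_mult:
  fixes q :: "'a :: comm_ring_1 poly"
  shows "coeff ([:1, -1:] * q) i = coeff q i - (if i = 0 then 0 else coeff q (i - 1))"
  by (cases i) (simp_all add: mult_pCons_left)

text \<open>At offset \<open>p\<close> only the summand \<open>m = 0\<close> is left, so the
  diagonal is constant and its geometric sum telescopes.\<close>

lemma diag_poly_ar_mat_extreme:
  assumes "2 * p \<le> N"
  shows "[:1, -1:] * diag_poly p (ar_mat p N \<alpha>) =
    Polynomial.smult (\<alpha> 0 * \<alpha> p) (1 - monom 1 (N - p + 1))"
proof (rule poly_eqI)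
  fix i
  have "coeff (diag_poly p (ar_mat p N \<alpha>)) i = (if i \<le> N - p then \<alpha> 0 * \<alpha> p else 0)" for i
    using assms by (auto simp: coeff_diag_poly ar_mat_def)
  thus "coeff ([:1, -1:] * diag_poly p (ar_mat p N \<alpha>)) i =
      coeff (Polynomial.smult (\<alpha> 0 * \<alpha> p) (1 - monom 1 (N - p + 1))) i"
    using coeff_one_minus_X_mult[of "diag_poly p (ar_mat p N \<alpha>)" i]
    by (auto simp: one_pCons coeff_pCons split: nat.splits)
qed

text \<open>Multiplying by \<open>1 - t\<close> takes differences of neighbouring entries: the
  prefix sums gain the squares up to index \<open>p\<close>, stay constant, and lose them in reverse
  order from index \<open>N - p + 1\<close> on.\<close>

lemma diag_poly_ar_mat_main:
  assumes "2 * p \<le> N"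
  shows "[:1, -1:] * diag_poly 0 (ar_mat p N \<alpha>) =
    (\<Sum>k\<le>p. monom ((\<alpha> k)\<^sup>2) k) - monom 1 (N - p + 1) * (\<Sum>k\<le>p. monom ((\<alpha> (p - k))\<^sup>2) k)"
proof (rule poly_eqI)
  fix i
  let ?W = "\<lambda>i. coeff (diag_poly 0 (ar_mat p N \<alpha>)) i"
  have W: "?W i = (if i \<le> N then \<Sum>m\<le>min (min i p) (N - i). (\<alpha> m)\<^sup>2 else 0)" for i
    using ar_mat_main_diagonal[OF assms, of i \<alpha>]
    by (auto simp: coeff_diag_poly ar_mat_def)
  have L: "coeff ([:1, -1:] * diag_poly 0 (ar_mat p N \<alpha>)) i = ?W i - (if i = 0 then 0 else ?W (i - 1))"
    by (rule coeff_one_minus_X_mult)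
  have R: "coeff ((\<Sum>k\<le>p. monom ((\<alpha> k)\<^sup>2) k) - monom 1 (N - p + 1) * (\<Sum>k\<le>p. monom ((\<alpha> (p - k))\<^sup>2) k)) i =
     (if i \<le> p then (\<alpha> i)\<^sup>2 else 0) -
     (if N - p + 1 \<le> i \<and> i \<le> N + 1 then (\<alpha> (N + 1 - i))\<^sup>2 else 0)"
    using assms by (auto simp: coeff_sum coeff_monom_mult intro!: arg_cong[where f = \<alpha>])
  \<comment> \<open>Index \<open>N + 1\<close> lies just past the diagonal: its coefficient is minus
    the last entry, \<open>(\<alpha> 0)\<^sup>2\<close>.\<close>
  consider "i = 0" | "0 < i" "i \<le> p" | "p < i" "i \<le> N - p" | "N - p < i" "i \<le> N" | "i = N + 1" | "N + 1 < i"
    by linarith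
  hence "?W i - (if i = 0 then 0 else ?W (i - 1)) = (if i \<le> p then (\<alpha> i)\<^sup>2 else 0) -
     (if N - p + 1 \<le> i \<and> i \<le> N + 1 then (\<alpha> (N + 1 - i))\<^sup>2 else 0)"
  proof cases
    case 2
    then obtain j where j: "i = Suc j" by (cases i) auto
    have "min (min (Suc j) p) (N - Suc j) = Suc j" "min (min j p) (N - j) = j"
      using 2 j assms by auto
    thus ?thesis
      using 2 j assms by (simp add: W)
  next
    case 3
    hence "min (min i p) (N - i) = p" "min (min (i - 1) p) (N - (i - 1)) = p"
      using assms by auto
    thus ?thesis
      using 3 assms by (auto simp: W)
  next
    case 4
    hence "min (min i p) (N - i) = N - i" "min (min (i - 1) p) (N - (i - 1)) = Suc (N - i)"
      "p < i" "i - 1 \<le> N"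
      using assms by auto
    thus ?thesis
      using 4 assms by (simp add: W Suc_diff_le)
  qed (use assms in \<open>auto simp: W\<close>)
  thus "coeff ([:1, -1:] * diag_poly 0 (ar_mat p N \<alpha>)) i =
    coeff ((\<Sum>k\<le>p. monom ((\<alpha> k)\<^sup>2) k) - monom 1 (N - p + 1) * (\<Sum>k\<le>p. monom ((\<alpha> (p - k))\<^sup>2) k)) i"
    unfolding L R .
qed

lemma ar_mat_conv_diagonal_imp:
  assumes pN: "2 * p \<le> N" and a0: "\<alpha> 0 \<noteq> 0" and ap: "\<alpha> p \<noteq> 0"
    and A: "A \<in> carrier_mat (a + 1) (a + 1)" and B: "B \<in> carrier_mat (b + 1) (b + 1)"
    and diag: "diagonal_mat B" and pb: "p \<le> b"
    and conv: "ar_mat p N \<alpha> = mat_conv A B"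
  shows "(\<alpha> p)\<^sup>2 = (\<alpha> 0)\<^sup>2"
proof -
  let ?b = "diag_poly 0 B"
  define U V where "U = (\<Sum>k\<le>p. monom ((\<alpha> k)\<^sup>2) k)" and "V = (\<Sum>k\<le>p. monom ((\<alpha> (p - k))\<^sup>2) k)"
  let ?D = "[:1, -1:] * ?b" and ?E = "1 - monom 1 (N - p + 1) :: real poly"
  have fac: "diag_poly d (ar_mat p N \<alpha>) = diag_poly d A * ?b" for d
    unfolding conv by (rule diag_poly_mat_conv[OF A B diag])
  have "dim_row (ar_mat p N \<alpha>) = dim_row (mat_conv A B)" using conv by simp
  hence N: "N = a + b" using A B by (simp add: ar_mat_def mat_conv_def Let_def)
  \<comment> \<open>The corner entry is nonzero, so the product has degree at least
    \<open>N = a + b\<close>; this forces \<open>?b\<close> to have degree at least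
    \<open>b\<close>.\<close>
  have cN: "coeff (diag_poly 0 A * ?b) N = (\<alpha> 0)\<^sup>2"
    using ar_mat_main_diagonal[OF pN, of N \<alpha>] by (simp flip: fac add: coeff_diag_poly ar_mat_def)
  have "N \<le> degree (diag_poly 0 A * ?b)" using cN a0 by (intro le_degree) simp
  also have "\<dots> \<le> degree (diag_poly 0 A) + degree ?b" by (rule degree_mult_le)
  also have "degree (diag_poly 0 A) \<le> a"
    using A by (intro degree_le) (auto simp: coeff_diag_poly)
  finally have "b \<le> degree ?b" using N by simp
  moreover have "?b \<noteq> 0" using cN a0 by auto
  \<comment> \<open>The factor \<open>1 - t\<close> supplies the strict inequality when
    \<open>b = p\<close>.\<close>
  ultimately have degD: "p < degree ?D" using pb by (simp add: degree_mult_eq del: mult_pCons_left)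
  have "?D dvd [:1, -1:] * diag_poly p (ar_mat p N \<alpha>)"
    unfolding fac by (intro mult_dvd_mono) simp_all
  hence D1: "?D dvd ?E"
    using a0 ap unfolding diag_poly_ar_mat_extreme[OF pN] by (simp add: dvd_smult_iff del: mult_pCons_left)
  have "?D dvd [:1, -1:] * diag_poly 0 (ar_mat p N \<alpha>)"
    unfolding fac by (intro mult_dvd_mono) simp_all
  hence D2: "?D dvd U - monom 1 (N - p + 1) * V"
    unfolding diag_poly_ar_mat_main[OF pN] U_def V_def .
  \<comment> \<open>Modulo \<open>?E\<close> the monomial in front of \<open>V\<close> is 1.\<close>
  have "U - V = (U - monom 1 (N - p + 1) * V) - ?E * V" by (simp add: algebra_simps)
  also have "?D dvd \<dots>" by (intro dvd_diff D2 dvd_mult2 D1)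
  finally have D3: "?D dvd U - V" .
  have "degree (U - V) \<le> p"
    by (intro degree_le) (auto simp: U_def V_def coeff_sum)
  hence "U - V = 0" using D3 degD dvd_imp_degree_le by fastforce
  hence "coeff U 0 = coeff V 0" by simp
  thus ?thesis by (simp add: U_def V_def coeff_sum)
qed

subsection \<open>Stationary autoregressive models\<close>

lemma integrable_mult_of_squares:
  fixes f g :: "'a \<Rightarrow> real"
  assumes [measurable]: "f \<in> borel_measurable M" "g \<in> borel_measurable M"
    and "integrable M (\<lambda>x. (f x)\<^sup>2)" "integrable M (\<lambda>x. (g x)\<^sup>2)"
  shows "integrable M (\<lambda>x. f x * g x)"
proof (rule Bochner_Integration.integrable_bound)
  show "integrable M (\<lambda>x. (f x)\<^sup>2 + (g x)\<^sup>2)" using assms by simp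
  have "\<bar>s * t\<bar> \<le> s\<^sup>2 + t\<^sup>2" for s t :: real
  proof -
    have "2 * \<bar>s\<bar> * \<bar>t\<bar> \<le> \<bar>s\<bar>\<^sup>2 + \<bar>t\<bar>\<^sup>2" by (rule sum_squares_bound)
    moreover have "0 \<le> \<bar>s\<bar> * \<bar>t\<bar>" by simp
    ultimately show ?thesis unfolding abs_mult power2_abs by linarith
  qed
  thus "AE x in M. norm (f x * g x) \<le> norm ((f x)\<^sup>2 + (g x)\<^sup>2)" by simp
qed simp

context stationary_ar
begin

text \<open>Time runs backwards: \<open>Y i\<close> is the centered \<open>\<xi> (-i)\<close>.\<close>
definition Y :: "nat \<Rightarrow> 'a \<Rightarrow> real" where
  "Y i \<omega> = \<xi> (- int i) \<omega> - expectation (\<xi> (- int i))"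

definition \<gamma> :: "nat \<Rightarrow> nat \<Rightarrow> real" where
  "\<gamma> i j = expectation (\<lambda>\<omega>. Y i \<omega> * Y j \<omega>)"

lemma square_integrable_Y:
  "Y i \<in> borel_measurable M" "integrable M (\<lambda>\<omega>. (Y i \<omega>)\<^sup>2)"
proof -
  have m[measurable]: "\<xi> n \<in> borel_measurable M" and s: "integrable M (\<lambda>\<omega>. (\<xi> n \<omega>)\<^sup>2)" for n
    using stationary by (auto simp: weakly_stationary_def)
  show "Y i \<in> borel_measurable M" unfolding Y_def by measurable
  have "integrable M (\<xi> n)" for n by (rule square_integrable_imp_integrable[OF m s])
  thus "integrable M (\<lambda>\<omega>. (Y i \<omega>)\<^sup>2)" using s by (simp add: Y_def power2_diff)
qed

lemma square_integrable_noise: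
  "\<epsilon> n \<in> borel_measurable M" "integrable M (\<lambda>\<omega>. (\<epsilon> n \<omega>)\<^sup>2)"
  using noise by (auto simp: unit_white_noise_def)

lemma integrable_YY: "integrable M (\<lambda>\<omega>. Y i \<omega> * Y j \<omega>)"
  by (intro integrable_mult_of_squares square_integrable_Y)

lemma integrable_Y_noise: "integrable M (\<lambda>\<omega>. Y i \<omega> * \<epsilon> n \<omega>)"
  by (intro integrable_mult_of_squares square_integrable_Y square_integrable_noise)

lemma expectation_Y_noise: "i > 0 \<Longrightarrow> expectation (\<lambda>\<omega>. Y i \<omega> * \<epsilon> 0 \<omega>) = 0"
  using innovation[of "- int i" 0] noise by (simp add: covariance_def Y_def unit_white_noise_def)

lemma expectation_noise_square: "expectation (\<lambda>\<omega>. (\<epsilon> 0 \<omega>)\<^sup>2) = 1"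
  using noise unfolding unit_white_noise_def
  by (metis (no_types, lifting) Bochner_Integration.integral_cong diff_zero)

lemma \<gamma>_sym: "\<gamma> i j = \<gamma> j i"
  by (simp add: \<gamma>_def mult.commute)

lemma \<gamma>_shift: "\<gamma> (i + k) (j + k) = \<gamma> i j"
proof -
  have "covariance (\<xi> (m + h)) (\<xi> (n + h)) = covariance (\<xi> m) (\<xi> n)" for m n h
    using stationary unfolding weakly_stationary_def by blast
  from this[of "- int i" "- int k" "- int j"] show ?thesis
    by (simp add: \<gamma>_def Y_def covariance_def)
qed

text \<open>Stationarity and symmetry make \<open>\<gamma>\<close> depend only on the distance of
  its indices, so second moments do not see the direction of time.\<close>

lemma \<gamma>_reverse:
  assumes "i \<le> k" "j \<le> k"
  shows "\<gamma> (k - i) (k - j) = \<gamma> i j"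
proof (cases "i \<le> j")
  case True
  thus ?thesis
    using assms \<gamma>_shift[of "j - i" "k - j" 0] \<gamma>_shift[of 0 i "j - i"] \<gamma>_sym[of "j - i" 0]
    by simp
next
  case False
  thus ?thesis
    using assms \<gamma>_shift[of 0 "k - i" "i - j"] \<gamma>_shift[of "i - j" j 0] \<gamma>_sym[of "i - j" 0]
    by simp
qed

text \<open>Taking expectations shows that the means satisfy the recursion without noise;
  subtracting it centers the process.\<close>

lemma recursion_Y: "AE \<omega> in M. Y 0 \<omega> = (\<Sum>i = 1..p. \<phi> i * Y i \<omega>) + \<epsilon> 0 \<omega>"
proof -
  have m[measurable]: "\<xi> n \<in> borel_measurable M" and s: "integrable M (\<lambda>\<omega>. (\<xi> n \<omega>)\<^sup>2)" for n
    using stationary by (auto simp: weakly_stationary_def)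
  have int: "integrable M (\<xi> n)" for n by (rule square_integrable_imp_integrable[OF m s])
  have inte: "integrable M (\<epsilon> 0)"
    by (rule square_integrable_imp_integrable[OF square_integrable_noise])
  have [measurable]: "\<epsilon> 0 \<in> borel_measurable M" by (rule square_integrable_noise)
  have rec: "AE \<omega> in M. \<xi> 0 \<omega> = (\<Sum>i = 1..p. \<phi> i * \<xi> (- int i) \<omega>) + \<epsilon> 0 \<omega>"
    using recursion[of 0] by simp
  have "expectation (\<xi> 0) = expectation (\<lambda>\<omega>. (\<Sum>i = 1..p. \<phi> i * \<xi> (- int i) \<omega>) + \<epsilon> 0 \<omega>)"
    by (rule integral_cong_AE) (use rec in auto)
  also have "\<dots> = (\<Sum>i = 1..p. \<phi> i * expectation (\<xi> (- int i)))"
    using noise int inte by (simp add: unit_white_noise_def)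
  finally have E: "expectation (\<xi> 0) = (\<Sum>i = 1..p. \<phi> i * expectation (\<xi> (- int i)))" .
  show ?thesis
    using rec by eventually_elim (simp add: Y_def E right_diff_distrib sum_subtractf)
qed

lemma expectation_lincomb_square:
  "expectation (\<lambda>\<omega>. (\<Sum>i\<in>I. u i * Y i \<omega>)\<^sup>2) = (\<Sum>i\<in>I. \<Sum>j\<in>I. u i * u j * \<gamma> i j)"
proof -
  have "(\<lambda>\<omega>. (\<Sum>i\<in>I. u i * Y i \<omega>)\<^sup>2) = (\<lambda>\<omega>. \<Sum>i\<in>I. \<Sum>j\<in>I. u i * u j * (Y i \<omega> * Y j \<omega>))"
    by (simp add: power2_eq_square sum_product mult_ac)
  thus ?thesis by (simp add: \<gamma>_def integrable_YY)
qed

text \<open>The variance depends on the process only through \<open>\<gamma>\<close>, which is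
  preserved when \<open>p - i\<close> replaces \<open>i\<close>.\<close>

lemma expectation_lincomb_reverse:
  "expectation (\<lambda>\<omega>. (\<Sum>i = 1..p. v i * Y i \<omega>)\<^sup>2) = expectation (\<lambda>\<omega>. (\<Sum>i<p. v (p - i) * Y i \<omega>)\<^sup>2)"
proof -
  have re: "(\<Sum>i = 1..p. f i) = (\<Sum>i<p. f (p - i))" for f :: "nat \<Rightarrow> real"
    by (rule sum.reindex_bij_witness[of _ "\<lambda>i. p - i" "\<lambda>i. p - i"]) auto
  have "(\<Sum>i = 1..p. \<Sum>j = 1..p. v i * v j * \<gamma> i j) =
        (\<Sum>i<p. \<Sum>j<p. v (p - i) * v (p - j) * \<gamma> i j)"
    unfolding re by (intro sum.cong refl) (simp add: \<gamma>_reverse)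
  thus ?thesis unfolding expectation_lincomb_square .
qed

text \<open>The innovation is uncorrelated with \<open>Y i\<close> for \<open>i > 0\<close>, so the
  cross terms vanish and its unit variance is added.\<close>

lemma expectation_noise_plus_past_square:
  "expectation (\<lambda>\<omega>. ((\<Sum>i = 1..p. v i * Y i \<omega>) + \<epsilon> 0 \<omega>)\<^sup>2) =
   expectation (\<lambda>\<omega>. (\<Sum>i = 1..p. v i * Y i \<omega>)\<^sup>2) + 1"
proof -
  let ?S = "\<lambda>\<omega>. \<Sum>i = 1..p. v i * Y i \<omega>"
  have "(\<lambda>\<omega>. (?S \<omega>)\<^sup>2) = (\<lambda>\<omega>. \<Sum>i = 1..p. \<Sum>j = 1..p. v i * v j * (Y i \<omega> * Y j \<omega>))"
    by (simp add: power2_eq_square sum_product mult_ac)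
  hence S: "integrable M (\<lambda>\<omega>. (?S \<omega>)\<^sup>2)" by (simp add: integrable_YY)
  have eq: "(\<lambda>\<omega>. (?S \<omega> + \<epsilon> 0 \<omega>)\<^sup>2) =
    (\<lambda>\<omega>. (?S \<omega>)\<^sup>2 + (\<epsilon> 0 \<omega>)\<^sup>2 + (\<Sum>i = 1..p. 2 * v i * (Y i \<omega> * \<epsilon> 0 \<omega>)))"
    by (simp add: power2_sum sum_distrib_left sum_distrib_right mult_ac)
  show ?thesis
    unfolding eq
    by (simp add: S square_integrable_noise integrable_Y_noise expectation_noise_square
        expectation_Y_noise del: One_nat_def)
qed

lemma prediction_error_step:
  assumes p: "p \<ge> 1" and \<phi>p: "\<phi> p \<noteq> 0" and u0: "u 0 = 1"
  obtains u' where "u' 0 = 1"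
    "expectation (\<lambda>\<omega>. (\<Sum>i<p. u i * Y i \<omega>)\<^sup>2) =
     1 + (\<phi> p)\<^sup>2 * expectation (\<lambda>\<omega>. (\<Sum>i<p. u' i * Y i \<omega>)\<^sup>2)"
proof
  \<comment> \<open>\<open>v\<close> collects the coefficients once the recursion replaces
    \<open>Y 0\<close>. As \<open>u\<close> is cut off before \<open>p\<close>, \<open>v p\<close>
    is \<open>\<phi> p\<close>; reversal moves it to index 0, and dividing by it restores the
    normalization.\<close>
  define v where "v i = \<phi> i + (if i < p then u i else 0)" for i
  define u' where "u' i = v (p - i) / \<phi> p" for i
  show "u' 0 = 1" using \<phi>p by (simp add: u'_def v_def)
  have [measurable]: "Y i \<in> borel_measurable M" "\<epsilon> 0 \<in> borel_measurable M" for i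
    by (rule square_integrable_Y square_integrable_noise)+
  have split: "(\<Sum>i<p. u i * Y i \<omega>) = Y 0 \<omega> + (\<Sum>i = 1..p. (if i < p then u i else 0) * Y i \<omega>)" for \<omega>
  proof -
    have "(\<Sum>i<p. u i * Y i \<omega>) = (\<Sum>i\<in>insert 0 {1..p}. (if i < p then u i else 0) * Y i \<omega>)"
      by (rule sum.mono_neutral_cong_left) auto
    thus ?thesis using p u0 by simp
  qed
  have "AE \<omega> in M. (\<Sum>i<p. u i * Y i \<omega>)\<^sup>2 = ((\<Sum>i = 1..p. v i * Y i \<omega>) + \<epsilon> 0 \<omega>)\<^sup>2"
    using recursion_Y by eventually_elim (simp add: split v_def distrib_right sum.distrib add_ac)
  hence "expectation (\<lambda>\<omega>. (\<Sum>i<p. u i * Y i \<omega>)\<^sup>2) =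
      expectation (\<lambda>\<omega>. ((\<Sum>i = 1..p. v i * Y i \<omega>) + \<epsilon> 0 \<omega>)\<^sup>2)"
    by (intro integral_cong_AE) auto
  also have "\<dots> = 1 + expectation (\<lambda>\<omega>. (\<Sum>i<p. v (p - i) * Y i \<omega>)\<^sup>2)"
    unfolding expectation_noise_plus_past_square expectation_lincomb_reverse by simp
  also have "(\<lambda>\<omega>. (\<Sum>i<p. v (p - i) * Y i \<omega>)\<^sup>2) = (\<lambda>\<omega>. (\<phi> p)\<^sup>2 * (\<Sum>i<p. u' i * Y i \<omega>)\<^sup>2)"
    using \<phi>p by (simp flip: power_mult_distrib add: sum_distrib_left u'_def)
  finally show "expectation (\<lambda>\<omega>. (\<Sum>i<p. u i * Y i \<omega>)\<^sup>2) =
     1 + (\<phi> p)\<^sup>2 * expectation (\<lambda>\<omega>. (\<Sum>i<p. u' i * Y i \<omega>)\<^sup>2)" by simp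
qed

lemma last_coefficient_less_1:
  assumes p: "p \<ge> 1" and \<phi>p: "\<phi> p \<noteq> 0"
  shows "\<bar>\<phi> p\<bar> < 1"
proof (rule ccontr)
  assume "\<not> \<bar>\<phi> p\<bar> < 1"
  hence ge: "1 \<le> (\<phi> p)\<^sup>2" by (simp add: abs_square_less_1 flip: not_less)
  let ?F = "\<lambda>u. expectation (\<lambda>\<omega>. (\<Sum>i<p. u i * Y i \<omega>)\<^sup>2)"
  \<comment> \<open>The bound is claimed for all normalized \<open>u\<close>, because every step
    passes to new coefficients.\<close>
  have "real n \<le> ?F u" if "u 0 = 1" for n u
    using that
  proof (induction n arbitrary: u)
    case (Suc n)
    obtain u' where u': "u' 0 = 1" "?F u = 1 + (\<phi> p)\<^sup>2 * ?F u'"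
      using prediction_error_step[where u = u, OF p \<phi>p Suc.prems] by blast
    have "real n \<le> ?F u'" by (rule Suc.IH) fact
    \<comment> \<open>\<open>?F u'\<close> is nonnegative, being the expectation of a
      square.\<close>
    also have "\<dots> \<le> (\<phi> p)\<^sup>2 * ?F u'" using mult_right_mono[OF ge, of "?F u'"] by simp
    finally show ?case using u' by simp
  qed simp
  from this[of "\<lambda>_. 1"] show False
    using reals_Archimedean2[of "?F (\<lambda>_. 1)"] by (meson not_less)
qed

end

theorem mainTheorem5:
  fixes p W :: nat and \<phi> \<alpha> :: "nat \<Rightarrow> real"
    and M :: "'a measure" and \<xi> \<epsilon> :: "int \<Rightarrow> 'a \<Rightarrow> real"
  assumes "p \<ge> 1" and "W \<ge> 2 * p"
    and "\<alpha> 0 = 1" and "\<And>i. 1 \<le> i \<Longrightarrow> i \<le> p \<Longrightarrow> \<alpha> i = - \<phi> i"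
    and "\<phi> p \<noteq> 0"
  shows "(\<bar>\<phi> p\<bar> < 1 \<longrightarrow>
           \<not> (\<exists>(a :: nat) (b :: nat) (A :: real mat) (B :: real mat).
                a > 0 \<and> b > 0 \<and> b \<ge> p \<and>
                A \<in> carrier_mat (a + 1) (a + 1) \<and>
                B \<in> carrier_mat (b + 1) (b + 1) \<and> diagonal_mat B \<and>
                ar_mat p W \<alpha> = mat_conv A B)) \<and>
         (stationary_ar M p \<phi> \<xi> \<epsilon> \<longrightarrow> \<bar>\<phi> p\<bar> < 1)"
proof (intro conjI impI notI)
  have ap: "\<alpha> p = - \<phi> p" using assms by simp
  assume lt: "\<bar>\<phi> p\<bar> < 1"
    and "\<exists>(a :: nat) (b :: nat) (A :: real mat) (B :: real mat).
                a > 0 \<and> b > 0 \<and> b \<ge> p \<and>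
                A \<in> carrier_mat (a + 1) (a + 1) \<and>
                B \<in> carrier_mat (b + 1) (b + 1) \<and> diagonal_mat B \<and>
                ar_mat p W \<alpha> = mat_conv A B"
  then obtain a b and A B :: "real mat" where
    "A \<in> carrier_mat (a + 1) (a + 1)" "B \<in> carrier_mat (b + 1) (b + 1)"
    "diagonal_mat B" "p \<le> b" "ar_mat p W \<alpha> = mat_conv A B"
    by blast
  hence "(\<alpha> p)\<^sup>2 = (\<alpha> 0)\<^sup>2"
    using assms ap by (intro ar_mat_conv_diagonal_imp[of p W \<alpha> A a B b]) auto
  hence "(\<phi> p)\<^sup>2 = 1" using ap assms(3) by simp
  thus False using lt by (simp add: abs_square_less_1[symmetric])
next
  assume "stationary_ar M p \<phi> \<xi> \<epsilon>"
  thus "\<bar>\<phi> p\<bar> < 1" using assms(1,5) by (rule stationary_ar.last_coefficient_less_1)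
qed

end
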